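(* Any function $f\in C^\infty(\mathbb{R}^2)^G\simeq C^\infty(\mathbb{R}^2/G)$ reads $$f(p,q)=\alpha_0(q)+\sum_{n\ge1}\alpha_n(q)\cos\left(2n\pi\frac{p}{q}\right)+\sum_{n\geq1}\beta_n(q)\sin\left(2n\pi\frac{p}{q}\right),$$ where $\alpha_0$ is a smooth function on $\mathbb{R}$ and where $(\alpha_n)_{n\ge1},(\beta_n)_{n\geq1}$ are smooth functions on $\mathbb{R}$ that vanish together with all their derivatives at $q=0$. Both above series, moreover, are absolutely convergent on any open ball.
   Context: $\mathbb{R}^2$ has coordinates $(p,q)$, and $G\simeq\mathbb{Z}$ acts by $n\cdot(p,q)=(p+nq,q)$; $C^\infty(\mathbb{R}^2)^G$ is the algebra of $G$-invariant real-valued smooth functions, also denoted $C^\infty(\mathbb{R}^2/G)$. For $n\ge1$ the terms $\alpha_n(q)\cos(2n\pi p/q)$ and $\beta_n(q)\sin(2n\pi p/q)$ are understood to be $0$ at $q=0$. *)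

theory Defs
  imports "HOL-Analysis.Analysis"
begin

text \<open>
  \<open>Ck k f\<close>: \<open>f\<close> is everywhere \<open>k\<close> times continuously differentiable. In finite dimension, the
  derivative as a map into linear forms is of class \<open>C^k\<close> iff all directional derivatives
  \<open>x \<mapsto> Df(x)v\<close> are.
\<close>

primrec Ck :: "nat \<Rightarrow> ('a::euclidean_space \<Rightarrow> real) \<Rightarrow> bool" where
  "Ck 0 f \<longleftrightarrow> continuous_on UNIV f"
| "Ck (Suc k) f \<longleftrightarrow>
     (\<forall>x. f differentiable (at x)) \<and> (\<forall>v. Ck k (\<lambda>x. frechet_derivative f (at x) v))"

definition smooth :: "('a::euclidean_space \<Rightarrow> real) \<Rightarrow> bool" where
  "smooth f \<longleftrightarrow> (\<forall>k. Ck k f)"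

definition flat_at :: "(real \<Rightarrow> real) \<Rightarrow> real \<Rightarrow> bool" where
  "flat_at g x \<longleftrightarrow> (\<forall>k. (deriv ^^ k) g x = 0)"

definition shear :: "int \<Rightarrow> real \<times> real \<Rightarrow> real \<times> real" where
  "shear n = (\<lambda>(p, q). (p + of_int n * q, q))"

definition smooth_invariant :: "(real \<times> real \<Rightarrow> real) set" where
  "smooth_invariant = {f. smooth f \<and> (\<forall>n x. f (shear n x) = f x)}"

definition cos_term :: "(nat \<Rightarrow> real \<Rightarrow> real) \<Rightarrow> nat \<Rightarrow> real \<times> real \<Rightarrow> real" where
  "cos_term \<alpha> n = (\<lambda>(p, q). if q = 0 then 0 else \<alpha> n q * cos (2 * real n * pi * (p / q)))"

definition sin_term :: "(nat \<Rightarrow> real \<Rightarrow> real) \<Rightarrow> nat \<Rightarrow> real \<times> real \<Rightarrow> real" where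
  "sin_term \<beta> n = (\<lambda>(p, q). if q = 0 then 0 else \<beta> n q * sin (2 * real n * pi * (p / q)))"

text \<open>
  Absolute convergence on a nonempty set \<open>S\<close> of the series of functions \<open>\<Sum>n\<ge>1. u n\<close>, i.e. absolute
  convergence in the sup norm on \<open>S\<close> (normal convergence); it implies uniform convergence on \<open>S\<close>
  and absolute convergence at every point of \<open>S\<close>. The boundedness clause is needed because \<open>SUP\<close>
  in the reals is meaningful only for sets that are bounded above.
\<close>

definition abs_convergent_on :: "'a set \<Rightarrow> (nat \<Rightarrow> 'a \<Rightarrow> real) \<Rightarrow> bool" where
  "abs_convergent_on S u \<longleftrightarrow>
     (\<forall>n\<ge>1. bounded (u n ` S)) \<and> summable (\<lambda>n. SUP x\<in>S. \<bar>u (Suc n) x\<bar>)"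

end

theory Submission
  imports Defs
begin

text \<open>
  For fixed \<open>q\<close>, invariance makes \<open>t \<mapsto> f (t * q, q)\<close> periodic with period 1, and \<open>\<alpha>\<close>, \<open>\<beta>\<close> are its
  Fourier coefficients; they are smooth in \<open>q\<close> by differentiation under the integral sign.
  Integration by parts in \<open>t\<close> produces a factor of order \<open>q / n\<close> and replaces \<open>f\<close> by
  \<open>\<partial>f/\<partial>p\<close>, which is again invariant. Hence the \<open>n\<close>-th coefficients are
  \<open>O((\<bar>q\<bar> / n) ^ m)\<close> for every \<open>m\<close>, locally uniformly in \<open>q\<close>: this gives both the flatness at
  \<open>q = 0\<close> and the convergence of the series. A periodic continuous function with absolutely
  summable Fourier coefficients is the sum of its Fourier series, by the Weierstrass theorem.
\<close>

subsection \<open>Fourier series\<close>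

text \<open>Multiplying by \<open>cos (2 * pi * t)\<close> averages the neighbouring frequencies
  \<open>n + 1\<close> and \<open>n - 1\<close>, so the induction on \<open>k\<close> must keep
  \<open>n\<close> arbitrary. This passes orthogonality from the cosines to all polynomials in
  \<open>cos (2 * pi * t)\<close>.\<close>

lemma integral_cos_powers_eq_0:
  fixes D :: "real \<Rightarrow> real"
  assumes D: "continuous_on {a..b} D"
    and orth: "\<And>n::nat. integral {a..b} (\<lambda>t. D t * cos (2 * real n * pi * t)) = 0"
  shows "integral {a..b} (\<lambda>t. D t * cos (2 * pi * t) ^ k * cos (2 * real n * pi * t)) = 0"
proof (induction k arbitrary: n)
  case 0
  show ?case using orth by simp
next
  case (Suc k)
  let ?I = "\<lambda>n::nat. \<lambda>t. D t * cos (2 * pi * t) ^ k * cos (2 * real n * pi * t)"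
  have int: "?I n integrable_on {a..b}" for n
    by (intro integrable_continuous_real continuous_intros D)
  show ?case
  proof (cases n)
    case 0
    \<comment> \<open>At frequency 0 there is no lower neighbour, but the new factor is itself the
      cosine of frequency 1.\<close>
    then have "(\<lambda>t. D t * cos (2 * pi * t) ^ Suc k * cos (2 * real n * pi * t)) = ?I 1"
      by (auto simp: mult_ac)
    then show ?thesis using Suc.IH[of 1] by simp
  next
    case (Suc m)
    have "D t * cos (2 * pi * t) ^ Suc k * cos (2 * real n * pi * t)
        = ?I (Suc n) t * (1/2) + ?I m t * (1/2)" for t
    proof -
      have "cos (2 * real (Suc n) * pi * t) + cos (2 * real m * pi * t)
          = cos (2 * real n * pi * t + 2 * pi * t) + cos (2 * real n * pi * t - 2 * pi * t)"
        by (simp add: Suc algebra_simps)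
      also have "\<dots> = 2 * (cos (2 * pi * t) * cos (2 * real n * pi * t))"
        by (simp only: cos_add cos_diff) simp
      finally have "cos (2 * pi * t) * cos (2 * real n * pi * t)
          = (cos (2 * real (Suc n) * pi * t) + cos (2 * real m * pi * t)) * (1/2)"
        by simp
      then have "D t * cos (2 * pi * t) ^ k * (cos (2 * pi * t) * cos (2 * real n * pi * t))
          = D t * cos (2 * pi * t) ^ k * ((cos (2 * real (Suc n) * pi * t) + cos (2 * real m * pi * t)) * (1/2))"
        by (simp only:)
      then show ?thesis by (simp only: power_Suc2 distrib_left distrib_right mult.assoc)
    qed
    then have "integral {a..b} (\<lambda>t. D t * cos (2 * pi * t) ^ Suc k * cos (2 * real n * pi * t))
        = integral {a..b} (\<lambda>t. ?I (Suc n) t * (1/2) + ?I m t * (1/2))"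
      by simp
    also have "\<dots> = integral {a..b} (\<lambda>t. ?I (Suc n) t * (1/2)) + integral {a..b} (\<lambda>t. ?I m t * (1/2))"
      by (intro Henstock_Kurzweil_Integration.integral_add integrable_on_mult_left int)
    also have "\<dots> = 0"
      using Suc.IH by (simp only: Henstock_Kurzweil_Integration.integral_mult_left)
    finally show ?thesis .
  qed
qed

text \<open>Since \<open>t \<mapsto> cos (2 * pi * t)\<close> is a homeomorphism from \<open>{0..1/2}\<close> onto \<open>{-1..1}\<close>, the
  Weierstrass theorem makes the polynomials in \<open>cos (2 * pi * t)\<close> uniformly dense.\<close>

lemma cosine_orthogonal_imp_0:
  fixes D :: "real \<Rightarrow> real"
  assumes D: "continuous_on {0..1/2} D"
    and orth: "\<And>n::nat. integral {0..1/2} (\<lambda>t. D t * cos (2 * real n * pi * t)) = 0"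
    and t: "t \<in> {0..1/2}"
  shows "D t = 0"
proof -
  have intD: "(\<lambda>t. \<bar>D t\<bar>) integrable_on {0..1/2}"
    by (intro integrable_continuous_real continuous_intros D)
  have intD2: "(\<lambda>t. D t * D t) integrable_on {0..1/2}"
    by (intro integrable_continuous_real continuous_intros D)
  \<comment> \<open>Take a polynomial \<open>g\<close> such that \<open>g (cos (2 * pi * t))\<close>
    is within \<open>e\<close> of \<open>D t\<close>. As \<open>D\<close> is orthogonal to it,
    subtracting it from one factor of \<open>D t * D t\<close> leaves the integral unchanged and
    makes that factor at most \<open>e\<close> in absolute value.\<close>
  have ub: "integral {0..1/2} (\<lambda>t. D t * D t) \<le> e * integral {0..1/2} (\<lambda>t. \<bar>D t\<bar>)"
    if "e > 0" for e :: real
  proof -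
    have "continuous_on {-1..1} (\<lambda>y. D (arccos y / (2 * pi)))"
    proof (rule continuous_on_compose2[OF D])
      show "continuous_on {-1..1} (\<lambda>y. arccos y / (2 * pi))"
        by (intro continuous_intros continuous_on_arccos') auto
      show "(\<lambda>y. arccos y / (2 * pi)) ` {-1..1} \<subseteq> {0..1/2}"
        using arccos_bounded by (auto simp: arccos_lbound arccos_ubound field_simps)
    qed
    then obtain g where g: "real_polynomial_function g"
      "\<And>y. y \<in> {-1..1} \<Longrightarrow> \<bar>D (arccos y / (2 * pi)) - g y\<bar> < e"
      using Stone_Weierstrass_real_polynomial_function[OF compact_Icc _ \<open>e > 0\<close>] by metis
    obtain a n where gs: "g = (\<lambda>x. \<Sum>i\<le>n. a i * x ^ i)"
      using g(1) real_polynomial_function_iff_sum by blast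
    have close: "\<bar>D t - g (cos (2 * pi * t))\<bar> \<le> e" if "t \<in> {0..1/2}" for t
    proof -
      have "arccos (cos (2 * pi * t)) = 2 * pi * t"
        using that by (intro arccos_cos) auto
      then have "arccos (cos (2 * pi * t)) / (2 * pi) = t" by simp
      then show ?thesis using g(2)[of "cos (2 * pi * t)"] by force
    qed
    have intDg: "(\<lambda>t. D t * (a i * cos (2 * pi * t) ^ i)) integrable_on {0..1/2}" for i
      by (intro integrable_continuous_real continuous_intros D)
    have term0: "integral {0..1/2} (\<lambda>t. D t * (a i * cos (2 * pi * t) ^ i)) = 0" for i
    proof -
      have "integral {0..1/2} (\<lambda>t. D t * (a i * cos (2 * pi * t) ^ i)) = integral {0..1/2} (\<lambda>t. a i * (D t * cos (2 * pi * t) ^ i))"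
        by (simp add: mult_ac)
      also have "\<dots> = a i * integral {0..1/2} (\<lambda>t. D t * cos (2 * pi * t) ^ i)"
        by (rule Henstock_Kurzweil_Integration.integral_mult_right)
      also have "\<dots> = 0" using integral_cos_powers_eq_0[OF D orth, of i 0] by simp
      finally show ?thesis .
    qed
    have z: "integral {0..1/2} (\<lambda>t. D t * g (cos (2 * pi * t))) = 0"
      unfolding gs sum_distrib_left
      by (subst Henstock_Kurzweil_Integration.integral_sum) (use intDg term0 in auto)
    have intg: "(\<lambda>t. D t * g (cos (2 * pi * t))) integrable_on {0..1/2}"
      unfolding gs by (intro integrable_continuous_real continuous_intros D)
    have "integral {0..1/2} (\<lambda>t. D t * D t)
        = integral {0..1/2} (\<lambda>t. D t * D t - D t * g (cos (2 * pi * t)))"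
      using z by (subst Henstock_Kurzweil_Integration.integral_diff[OF intD2 intg]) simp
    also have "\<dots> \<le> integral {0..1/2} (\<lambda>t. e * \<bar>D t\<bar>)"
    proof (rule integral_le)
      fix t :: real assume t: "t \<in> {0..1/2}"
      have "D t * D t - D t * g (cos (2 * pi * t)) \<le> \<bar>D t * (D t - g (cos (2 * pi * t)))\<bar>"
        by (simp add: right_diff_distrib)
      also have "\<dots> = \<bar>D t - g (cos (2 * pi * t))\<bar> * \<bar>D t\<bar>" by (simp add: abs_mult)
      also have "\<dots> \<le> e * \<bar>D t\<bar>" by (intro mult_right_mono close t) simp
      finally show "D t * D t - D t * g (cos (2 * pi * t)) \<le> e * \<bar>D t\<bar>" .
    qed (intro integrable_diff intD2 intg integrable_on_mult_right intD)+
    finally show ?thesis by simp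
  qed
  have "((\<lambda>e. e * integral {0..1/2} (\<lambda>t. \<bar>D t\<bar>)) \<longlongrightarrow> 0 * integral {0..1/2} (\<lambda>t. \<bar>D t\<bar>)) (at_right 0)"
    by (intro tendsto_intros)
  then have "integral {0..1/2} (\<lambda>t. D t * D t) \<le> 0"
    by (intro tendsto_lowerbound[where F = "at_right (0::real)" and f = "\<lambda>e. e * integral {0..1/2} (\<lambda>t. \<bar>D t\<bar>)"])
      (auto simp: eventually_at_filter ub)
  moreover have "integral {0..1/2} (\<lambda>t. D t * D t) \<ge> 0"
    by (rule Henstock_Kurzweil_Integration.integral_nonneg[OF intD2]) auto
  ultimately have "integral {0..1/2} (\<lambda>t. D t * D t) = 0" by simp
  moreover have "continuous_on {0..1/2} (\<lambda>t. D t * D t)"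
    by (intro continuous_intros D)
  ultimately have "\<forall>t\<in>{0..1/2}. D t * D t = 0"
    by (subst (asm) integral_eq_0_iff) auto
  then show ?thesis using t by auto
qed

section \<open>Cosine series on a half period\<close>

lemma integral_cos_half_period:
  "integral {0..1/2} (\<lambda>t. cos (2 * real n * pi * t)) = (if n = 0 then 1/2 else 0)"
proof (cases "n = 0")
  case False
  have "((\<lambda>t. cos (2 * real n * pi * t)) has_integral
      sin (2 * real n * pi * (1/2)) / (2 * real n * pi) - sin (2 * real n * pi * 0) / (2 * real n * pi)) {0..1/2}"
  proof (rule fundamental_theorem_of_calculus)
    fix t :: real
    show "((\<lambda>t. sin (2 * real n * pi * t) / (2 * real n * pi)) has_vector_derivative cos (2 * real n * pi * t))
        (at t within {0..1/2})"
      using False by (auto intro!: derivative_eq_intros simp flip: has_real_derivative_iff_has_vector_derivative)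
  qed simp
  then show ?thesis using False by (simp add: integral_unique)
qed simp

lemma integral_cos_cos_half_period:
  "integral {0..1/2} (\<lambda>t. cos (2 * real m * pi * t) * cos (2 * real n * pi * t))
    = (if m = n then if n = 0 then 1/2 else 1/4 else 0)"
proof -
  \<comment> \<open>The distance between \<open>m\<close> and \<open>n\<close> as a natural number;
    since cosine is even, it can stand for either difference.\<close>
  define d where "d = (if m \<le> n then n - m else m - n)"
  have int: "(\<lambda>t. cos (2 * real k * pi * t)) integrable_on {0..1/2}" for k :: nat
    by (intro integrable_continuous_real continuous_intros)
  have "cos (2 * real m * pi * t) * cos (2 * real n * pi * t)
      = cos (2 * real (m + n) * pi * t) * (1/2) + cos (2 * real d * pi * t) * (1/2)" for t
  proof -
    have "cos (2 * real d * pi * t) = cos (2 * real m * pi * t - 2 * real n * pi * t)"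
    proof (cases "m \<le> n")
      case True
      then have "2 * real d * pi * t = - (2 * real m * pi * t - 2 * real n * pi * t)"
        by (simp add: d_def of_nat_diff algebra_simps)
      then show ?thesis by (metis cos_minus)
    next
      case False
      then show ?thesis by (simp add: d_def of_nat_diff algebra_simps)
    qed
    moreover have "cos (2 * real (m + n) * pi * t) = cos (2 * real m * pi * t + 2 * real n * pi * t)"
      by (simp add: algebra_simps)
    ultimately show ?thesis by (simp only: cos_add cos_diff) (simp add: field_simps)
  qed
  then have "integral {0..1/2} (\<lambda>t. cos (2 * real m * pi * t) * cos (2 * real n * pi * t))
      = integral {0..1/2} (\<lambda>t. cos (2 * real (m + n) * pi * t) * (1/2) + cos (2 * real d * pi * t) * (1/2))"
    by simp
  also have "\<dots> = integral {0..1/2} (\<lambda>t. cos (2 * real (m + n) * pi * t)) * (1/2)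
      + integral {0..1/2} (\<lambda>t. cos (2 * real d * pi * t)) * (1/2)"
    by (subst Henstock_Kurzweil_Integration.integral_add) (intro integrable_on_mult_left int, intro integrable_on_mult_left int, simp only: Henstock_Kurzweil_Integration.integral_mult_left)
  finally show ?thesis
    unfolding integral_cos_half_period by (auto simp: d_def)
qed

text \<open>The cosine series converges uniformly by the M-test, so its sum is continuous and may be
  integrated term by term. It then has the same cosine coefficients as \<open>E\<close>, and the
  difference vanishes by \<open>cosine_orthogonal_imp_0\<close>.\<close>

lemma cosine_expansion:
  fixes E :: "real \<Rightarrow> real"
  assumes E: "continuous_on {0..1/2} E"
  defines "c \<equiv> \<lambda>n::nat. integral {0..1/2} (\<lambda>t. E t * cos (2 * real n * pi * t))"
  assumes c: "summable (\<lambda>n. \<bar>c n\<bar>)"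
    and t: "t \<in> {0..1/2}"
  shows "E t = 2 * c 0 + 4 * (\<Sum>n. c (Suc n) * cos (2 * real (Suc n) * pi * t))"
proof -
  \<comment> \<open>The factors 2 and 4 are the reciprocals of the integrals 1/2 and 1/4 of the
    squared cosines.\<close>
  define d where "d n = (if n = 0 then 2 else 4) * c n" for n
  define S where "S t = (\<Sum>n. d n * cos (2 * real n * pi * t))" for t
  define P where "P N t = (\<Sum>n<N. d n * cos (2 * real n * pi * t))" for N t
  have sd: "summable (\<lambda>n. 4 * \<bar>c n\<bar>)" by (intro summable_mult c)
  have dle: "\<bar>d n * cos (2 * real n * pi * t)\<bar> \<le> 4 * \<bar>c n\<bar>" for n t
  proof -
    have "\<bar>d n * cos (2 * real n * pi * t)\<bar> = \<bar>d n\<bar> * \<bar>cos (2 * real n * pi * t)\<bar>" by (rule abs_mult)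
    also have "\<dots> \<le> (4 * \<bar>c n\<bar>) * 1" by (intro mult_mono) (auto simp: d_def abs_mult)
    finally show ?thesis by simp
  qed
  have ul: "uniform_limit UNIV P S sequentially"
    unfolding P_def S_def
    by (rule Weierstrass_m_test[OF _ sd]) (simp only: real_norm_def dle)
  have contP: "continuous_on A (P N)" for A N
    unfolding P_def by (intro continuous_intros)
  have contS: "continuous_on A S" for A
    using uniform_limit_theorem[OF _ ul] contP by (auto intro: continuous_on_subset)
  have coeff: "integral {0..1/2} (\<lambda>t. S t * cos (2 * real m * pi * t)) = c m" for m
  proof -
    \<comment> \<open>Uniform convergence survives multiplication by a bounded function, which
      allows the limit to pass under the integral.\<close>
    have "uniform_limit {0..1/2} (\<lambda>N t. P N t * cos (2 * real m * pi * t)) (\<lambda>t. S t * cos (2 * real m * pi * t)) sequentially"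
    proof (rule uniform_lim_mult)
      show "uniform_limit {0..1/2} P S sequentially"
        using ul by (rule uniform_limit_on_subset) simp
      show "bounded (S ` {0..1/2})"
        by (intro compact_imp_bounded compact_continuous_image contS) simp
      show "bounded ((\<lambda>t. cos (2 * real m * pi * t)) ` {0..1/2})"
        by (rule boundedI[of _ 1]) auto
    qed (auto intro: uniform_limit_const)
    then obtain I J where IJ:
      "\<And>N. ((\<lambda>t. P N t * cos (2 * real m * pi * t)) has_integral I N) {0..1/2}"
      "((\<lambda>t. S t * cos (2 * real m * pi * t)) has_integral J) {0..1/2}" "I \<longlonglongrightarrow> J"
      by (rule uniform_limit_integral) (auto intro!: continuous_intros contP)
    \<comment> \<open>Once the partial sum contains index \<open>m\<close>, orthogonality retains
      exactly that term, so \<open>I\<close> is eventually constant.\<close>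
    have "I N = c m" if "N > m" for N
    proof -
      have "I N = integral {0..1/2} (\<lambda>t. \<Sum>n<N. d n * (cos (2 * real n * pi * t) * cos (2 * real m * pi * t)))"
        using IJ(1)[of N, THEN integral_unique] by (simp only: P_def sum_distrib_right mult.assoc)
      also have "\<dots> = (\<Sum>n<N. integral {0..1/2} (\<lambda>t. d n * (cos (2 * real n * pi * t) * cos (2 * real m * pi * t))))"
        by (intro Henstock_Kurzweil_Integration.integral_sum integrable_continuous_real continuous_intros) auto
      also have "\<dots> = (\<Sum>n<N. d n * (if n = m then if m = 0 then 1/2 else 1/4 else 0))"
        by (simp only: Henstock_Kurzweil_Integration.integral_mult_right integral_cos_cos_half_period)
      also have "\<dots> = (\<Sum>n<N. if n = m then c m else 0)"
        by (intro sum.cong) (auto simp: d_def)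
      also have "\<dots> = c m" using that by simp
      finally show ?thesis .
    qed
    then have "I \<longlonglongrightarrow> c m"
      by (intro tendsto_eventually) (auto simp: eventually_sequentially intro!: exI[of _ "Suc m"])
    then have "J = c m" using IJ(3) LIMSEQ_unique by blast
    then show ?thesis using IJ(2) by (simp add: integral_unique)
  qed
  have "E t - S t = 0"
  proof (rule cosine_orthogonal_imp_0[OF _ _ t])
    show "continuous_on {0..1/2} (\<lambda>t. E t - S t)" by (intro continuous_intros E contS)
    fix n :: nat
    have "integral {0..1/2} (\<lambda>t. (E t - S t) * cos (2 * real n * pi * t))
        = integral {0..1/2} (\<lambda>t. E t * cos (2 * real n * pi * t) - S t * cos (2 * real n * pi * t))"
      by (simp add: left_diff_distrib)
    also have "\<dots> = c n - c n"
      unfolding coeff[symmetric, of n] unfolding coeff c_def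
      by (subst Henstock_Kurzweil_Integration.integral_diff)
        (auto intro!: integrable_continuous_real continuous_intros E contS simp: coeff c_def)
    finally show "integral {0..1/2} (\<lambda>t. (E t - S t) * cos (2 * real n * pi * t)) = 0" by simp
  qed
  then have "E t = S t" by simp
  \<comment> \<open>Index 0 is split off because its normalising factor differs from the
    others.\<close>
  also have "S t = d 0 * cos (2 * real 0 * pi * t) + (\<Sum>n. d (Suc n) * cos (2 * real (Suc n) * pi * t))"
  proof -
    have "summable (\<lambda>n. d n * cos (2 * real n * pi * t))"
      using dle by (intro summable_comparison_test'[OF sd]) auto
    from suminf_split_head[OF this] show ?thesis unfolding S_def by simp
  qed
  also have "\<dots> = 2 * c 0 + (\<Sum>n. 4 * (c (Suc n) * cos (2 * real (Suc n) * pi * t)))"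
    by (simp add: d_def mult_ac)
  also have "\<dots> = 2 * c 0 + 4 * (\<Sum>n. c (Suc n) * cos (2 * real (Suc n) * pi * t))"
  proof (subst suminf_mult)
    have s: "summable (\<lambda>n. \<bar>c (Suc n)\<bar>)" using c by (subst summable_Suc_iff)
    have le: "\<bar>c (Suc n) * cos (2 * real (Suc n) * pi * t)\<bar> \<le> \<bar>c (Suc n)\<bar>" for n
      by (simp only: abs_mult) (metis abs_cos_le_one abs_ge_zero mult_left_le)
    show "summable (\<lambda>n. c (Suc n) * cos (2 * real (Suc n) * pi * t))"
      by (rule summable_comparison_test'[OF s, where N = 0]) (simp only: real_norm_def le)
  qed simp
  finally show ?thesis .
qed

section \<open>Fourier series of functions of period 1\<close>

text \<open>Cut \<open>{a..a+1}\<close> at the integer just above the floor of \<open>a\<close> and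
  move the right piece back by one period: the pieces then fill an interval between consecutive
  integers, which an integer shift carries to \<open>{0..1}\<close>.\<close>

lemma integral_periodic_shift:
  fixes g :: "real \<Rightarrow> real"
  assumes g: "continuous_on UNIV g" and per: "\<And>t. g (t + 1) = g t"
  shows "integral {a..a+1} g = integral {0..1} g"
proof -
  have int: "g integrable_on {x..y}" for x y
    using g by (intro integrable_continuous_real) (auto intro: continuous_on_subset)
  have shift1: "integral {x+1..y+1} g = integral {x..y} g" for x y
    using integral_shift_real_ivl[of "x+1" 1 "y+1" g] by (simp add: per)
  have shift_nat: "integral {x + real n..y + real n} g = integral {x..y} g" for x y n
  proof (induction n)
    case (Suc n)
    then show ?case using shift1[of "x + real n" "y + real n"] by (simp add: add_ac)
  qed simp
  have unit: "integral {of_int k..of_int k + 1} g = integral {0..1} g" for k :: int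
  proof (cases "k \<ge> 0")
    case True
    then show ?thesis using shift_nat[of 0 "nat k" 1] by (simp add: add_ac)
  next
    case False
    then show ?thesis using shift_nat[of "of_int k" "nat (-k)" "of_int k + 1"] by simp
  qed
  define n where "n = real_of_int \<lfloor>a\<rfloor>"
  have n: "n \<le> a" "a \<le> n + 1" unfolding n_def by linarith+
  have "integral {a..a+1} g = integral {a..n+1} g + integral {n+1..a+1} g"
    using n by (intro Henstock_Kurzweil_Integration.integral_combine[symmetric] int) auto
  also have "\<dots> = integral {n..a} g + integral {a..n+1} g" by (simp add: shift1)
  also have "\<dots> = integral {n..n+1} g"
    using n by (intro Henstock_Kurzweil_Integration.integral_combine int) auto
  also have "\<dots> = integral {0..1} g" unfolding n_def by (rule unit)
  finally show ?thesis .
qed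

text \<open>Reduced to a cosine series in \<open>t\<close>, evaluated at \<open>t = 0\<close>, by symmetrising \<open>h\<close> about \<open>x\<close>.\<close>

lemma periodic_fourier_expansion:
  fixes h :: "real \<Rightarrow> real"
  assumes h: "continuous_on UNIV h" and per: "\<And>t. h (t + 1) = h t"
  defines "A \<equiv> \<lambda>n::nat. integral {0..1} (\<lambda>t. h t * cos (2 * real n * pi * t))"
  defines "B \<equiv> \<lambda>n::nat. integral {0..1} (\<lambda>t. h t * sin (2 * real n * pi * t))"
  assumes A: "summable (\<lambda>n. \<bar>A n\<bar>)" and B: "summable (\<lambda>n. \<bar>B n\<bar>)"
  shows "h x = A 0 + (\<Sum>n. 2 * A (Suc n) * cos (2 * real (Suc n) * pi * x))
                   + (\<Sum>n. 2 * B (Suc n) * sin (2 * real (Suc n) * pi * x))"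
proof -
  have contf: "continuous_on S (\<lambda>t. h (f t))" if "continuous_on S f" for S :: "real set" and f
    using that by (intro continuous_on_compose2[OF h]) auto
  \<comment> \<open>This is the half-period cosine coefficient of the symmetrised function. After
    the substitution \<open>u = x + t\<close> the weight is
    \<open>cos (2 * real n * pi * (u - x))\<close>, and the addition formula separates
    \<open>x\<close> from \<open>u\<close>.\<close>
  define e where "e n = A n * cos (2 * real n * pi * x) + B n * sin (2 * real n * pi * x)" for n
  have coeff: "integral {0..1/2} (\<lambda>t. (h (x + t) + h (x - t)) * cos (2 * real n * pi * t)) = e n" for n
  proof -
    let ?g = "\<lambda>t. h (x + t) * cos (2 * real n * pi * t)"
    have intg: "?g integrable_on {a..b}" for a b
      by (intro integrable_continuous_real continuous_intros contf)
    have "integral {0..1/2} (\<lambda>t. (h (x + t) + h (x - t)) * cos (2 * real n * pi * t))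
        = integral {0..1/2} (\<lambda>t. ?g t + ?g (- t))"
      by (simp add: algebra_simps)
    also have "\<dots> = integral {0..1/2} ?g + integral {0..1/2} (\<lambda>t. ?g (- t))"
      by (intro Henstock_Kurzweil_Integration.integral_add integrable_continuous_real continuous_intros contf)
    \<comment> \<open>Reflection turns the second summand into the missing half, so that the two
      together cover one full period.\<close>
    also have "integral {0..1/2} (\<lambda>t. ?g (- t)) = integral {-1/2..0} ?g"
      using Henstock_Kurzweil_Integration.integral_reflect_real[of 0 "-1/2" ?g] by simp
    also have "integral {0..1/2} ?g + integral {-1/2..0} ?g = integral {-1/2..1/2} ?g"
      by (subst add.commute, rule Henstock_Kurzweil_Integration.integral_combine) (use intg in auto)
    also have "\<dots> = integral {(x-1/2)-x..(x+1/2)-x} (\<lambda>t. h (t + x) * cos (2 * real n * pi * ((t + x) - x)))"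
      by (simp add: add_ac)
    also have "\<dots> = integral {x-1/2..x+1/2} (\<lambda>u. h u * cos (2 * real n * pi * (u - x)))"
      by (rule integral_shift_real_ivl)
    also have "\<dots> = integral {x-1/2..(x-1/2)+1} (\<lambda>u. h u * cos (2 * real n * pi * (u - x)))"
      by (rule arg_cong[where f = "\<lambda>b. integral {x-1/2..b} _"]) simp
    also have "\<dots> = integral {0..1} (\<lambda>u. h u * cos (2 * real n * pi * (u - x)))"
    proof (rule integral_periodic_shift)
      show "continuous_on UNIV (\<lambda>u. h u * cos (2 * real n * pi * (u - x)))"
        by (intro continuous_intros h)
      fix t
      have "cos (2 * real n * pi * (t + 1 - x)) = cos (2 * real n * pi * (t - x) + 2 * real n * pi)"
        by (simp add: algebra_simps)
      then show "h (t + 1) * cos (2 * real n * pi * (t + 1 - x)) = h t * cos (2 * real n * pi * (t - x))"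
        by (simp only: per cos_add cos_2npi sin_2npi)
          simp
    qed
    also have "\<dots> = integral {0..1} (\<lambda>u. h u * cos (2 * real n * pi * u) * cos (2 * real n * pi * x)
        + h u * sin (2 * real n * pi * u) * sin (2 * real n * pi * x))"
      by (simp only: right_diff_distrib cos_diff distrib_left mult.assoc)
    also have "\<dots> = integral {0..1} (\<lambda>u. h u * cos (2 * real n * pi * u) * cos (2 * real n * pi * x))
        + integral {0..1} (\<lambda>u. h u * sin (2 * real n * pi * u) * sin (2 * real n * pi * x))"
      by (intro Henstock_Kurzweil_Integration.integral_add integrable_continuous_real continuous_intros contf)
    also have "\<dots> = e n"
      by (simp only: Henstock_Kurzweil_Integration.integral_mult_left e_def A_def B_def)
    finally show ?thesis .
  qed
  have "\<bar>e n\<bar> \<le> \<bar>A n\<bar> + \<bar>B n\<bar>" for n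
  proof -
    have "\<bar>e n\<bar> \<le> \<bar>A n * cos (2 * real n * pi * x)\<bar> + \<bar>B n * sin (2 * real n * pi * x)\<bar>"
      unfolding e_def by (rule abs_triangle_ineq)
    also have "\<dots> \<le> \<bar>A n\<bar> + \<bar>B n\<bar>"
      by (intro add_mono) (simp_all add: abs_mult mult_left_le)
    finally show ?thesis .
  qed
  then have "summable (\<lambda>n. \<bar>e n\<bar>)"
    by (intro summable_comparison_test'[OF summable_add[OF A B]]) auto
  \<comment> \<open>At \<open>t = 0\<close> the symmetrised function takes the value
    \<open>2 * h x\<close> and every cosine equals 1.\<close>
  then have "h (x + 0) + h (x - 0) = 2 * e 0 + 4 * (\<Sum>n. e (Suc n) * cos (2 * real (Suc n) * pi * 0))"
    unfolding coeff[symmetric]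
    by (intro cosine_expansion) (auto intro!: continuous_intros contf)
  then have hx: "h x = e 0 + 2 * (\<Sum>n. e (Suc n))" by simp
  have sA: "summable (\<lambda>n. 2 * A (Suc n) * cos (2 * real (Suc n) * pi * x))"
  proof (rule summable_comparison_test')
    show "summable (\<lambda>n. 2 * \<bar>A (Suc n)\<bar>)" using A by (intro summable_mult) (subst summable_Suc_iff)
    show "norm (2 * A (Suc n) * cos (2 * real (Suc n) * pi * x)) \<le> 2 * \<bar>A (Suc n)\<bar>" for n
      unfolding real_norm_def abs_mult by (rule order_trans[OF mult_left_le]) auto
  qed
  have sB: "summable (\<lambda>n. 2 * B (Suc n) * sin (2 * real (Suc n) * pi * x))"
  proof (rule summable_comparison_test')
    show "summable (\<lambda>n. 2 * \<bar>B (Suc n)\<bar>)" using B by (intro summable_mult) (subst summable_Suc_iff)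
    show "norm (2 * B (Suc n) * sin (2 * real (Suc n) * pi * x)) \<le> 2 * \<bar>B (Suc n)\<bar>" for n
      unfolding real_norm_def abs_mult by (rule order_trans[OF mult_left_le]) auto
  qed
  have "2 * (\<Sum>n. e (Suc n)) = (\<Sum>n. 2 * e (Suc n))"
    using \<open>summable (\<lambda>n. \<bar>e n\<bar>)\<close> by (intro suminf_mult[symmetric]) (subst summable_Suc_iff, rule summable_rabs_cancel)
  also have "\<dots> = (\<Sum>n. 2 * A (Suc n) * cos (2 * real (Suc n) * pi * x) + 2 * B (Suc n) * sin (2 * real (Suc n) * pi * x))"
    by (simp add: e_def algebra_simps)
  also have "\<dots> = (\<Sum>n. 2 * A (Suc n) * cos (2 * real (Suc n) * pi * x))
                   + (\<Sum>n. 2 * B (Suc n) * sin (2 * real (Suc n) * pi * x))"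
    by (rule suminf_add[OF sA sB, symmetric])
  finally show ?thesis using hx by (simp add: e_def)
qed

subsection \<open>Calculus of smooth functions\<close>

lemma frechet_derivative_linear_combination:
  fixes f g :: "'a::euclidean_space \<Rightarrow> real"
  assumes "f differentiable at x" "g differentiable at x"
  shows "frechet_derivative (\<lambda>x. a * f x + b * g x) (at x) v
    = a * frechet_derivative f (at x) v + b * frechet_derivative g (at x) v"
proof -
  have "((\<lambda>x. a * f x + b * g x) has_derivative
      (\<lambda>v. a * frechet_derivative f (at x) v + b * frechet_derivative g (at x) v)) (at x)"
    using assms by (intro derivative_intros) (auto simp: frechet_derivative_works)
  from fun_cong[OF frechet_derivative_at[OF this], of v] show ?thesis by (rule sym)
qed

text \<open>The closure property behind \<open>Ck_wavg\<close>, where directional derivatives of an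
  average are linear combinations of two averages.\<close>

lemma Ck_linear_combination:
  assumes "Ck k f" "Ck k g"
  shows "Ck k (\<lambda>x. a * f x + b * g x)"
  using assms
proof (induction k arbitrary: f g)
  case 0
  then show ?case by (auto intro!: continuous_intros)
next
  case (Suc k)
  then have diff: "f differentiable at x" "g differentiable at x" for x by simp_all
  have "(\<lambda>x. a * f x + b * g x) differentiable at x" for x
    by (intro differentiable_add differentiable_mult differentiable_const diff)
  then show ?case
    using Suc by (simp add: frechet_derivative_linear_combination[OF diff])
qed

lemma Ck_cmult: "Ck k f \<Longrightarrow> Ck k (\<lambda>x. a * f x)"
  using Ck_linear_combination[of k f f a 0] by simp

lemma smooth_differentiable: "smooth f \<Longrightarrow> f differentiable at x"
  unfolding smooth_def by (drule spec[of _ "Suc 0"]) simp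

lemma smooth_frechet_derivative: "smooth f \<Longrightarrow> smooth (\<lambda>x. frechet_derivative f (at x) v)"
  unfolding smooth_def by (rule allI, drule_tac x = "Suc k" in spec) simp

lemma smooth_continuous_on: "smooth f \<Longrightarrow> continuous_on S f"
  unfolding smooth_def by (drule spec[of _ 0]) (auto intro: continuous_on_subset)

lemma smooth_has_derivative: "smooth f \<Longrightarrow> (f has_derivative frechet_derivative f (at x)) (at x)"
  using smooth_differentiable frechet_derivative_works by blast

lemma smooth_has_deriv:
  fixes g :: "real \<Rightarrow> real"
  assumes "smooth g"
  shows "(g has_real_derivative deriv g x) (at x)"
  using smooth_differentiable[OF assms] by (simp add: DERIV_deriv_iff_real_differentiable)

lemma smooth_deriv:
  fixes g :: "real \<Rightarrow> real"
  assumes "smooth g"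
  shows "smooth (deriv g)"
proof -
  have "frechet_derivative g (at x) 1 = deriv g x" for x
    using smooth_has_deriv[OF assms, of x]
    by (metis frechet_derivative_at has_field_derivative_def mult.right_neutral)
  then show ?thesis using smooth_frechet_derivative[OF assms, of 1] by simp
qed

lemma smooth_funpow_deriv:
  fixes g :: "real \<Rightarrow> real"
  shows "smooth g \<Longrightarrow> smooth ((deriv ^^ k) g)"
  by (induction k) (auto intro: smooth_deriv)

section \<open>Flatness from decay faster than every power\<close>

text \<open>Strong induction on the order \<open>k\<close>: in the Maclaurin formula the lower terms
  vanish, so \<open>a / fact k * x ^ k\<close> is the difference of \<open>g x\<close> and the
  remainder, both of order \<open>x ^ Suc k\<close>. Dividing by \<open>x ^ k\<close> and letting
  \<open>x\<close> tend to 0 from the right forces \<open>a = 0\<close>.\<close>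

lemma flat_at_0I:
  fixes g :: "real \<Rightarrow> real"
  assumes g: "smooth g"
    and bound: "\<And>m. \<exists>C. \<forall>q. \<bar>q\<bar> \<le> 1 \<longrightarrow> \<bar>g q\<bar> \<le> C * \<bar>q\<bar> ^ m"
  shows "flat_at g 0"
  unfolding flat_at_def
proof
  fix k
  show "(deriv ^^ k) g 0 = 0"
  proof (induction k rule: less_induct)
    case (less k)
    define a where "a = (deriv ^^ k) g 0"
    \<comment> \<open>\<open>B\<close> controls the Lagrange remainder on \<open>{-1..1}\<close>;
      \<open>C\<close> is the decay constant for the exponent one above \<open>k\<close>.\<close>
    obtain B where B: "\<And>t. t \<in> {-1..1} \<Longrightarrow> \<bar>(deriv ^^ Suc k) g t\<bar> \<le> B"
      using continuous_on_compact_bound[OF compact_Icc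
          smooth_continuous_on[OF smooth_funpow_deriv[OF g]], of "-1" 1 "Suc k"]
      unfolding real_norm_def by metis
    obtain C where C: "\<And>q. \<bar>q\<bar> \<le> 1 \<Longrightarrow> \<bar>g q\<bar> \<le> C * \<bar>q\<bar> ^ Suc k"
      using bound[of "Suc k"] by blast
    have le: "\<bar>a / fact k\<bar> \<le> (C + B / fact (Suc k)) * x" if x: "0 < x" "x \<le> 1" for x
    proof -
      have "\<exists>t. \<bar>t\<bar> \<le> \<bar>x\<bar> \<and> g x = (\<Sum>m<Suc k. ((deriv ^^ m) g 0 / fact m) * x ^ m)
          + ((deriv ^^ Suc k) g t / fact (Suc k)) * x ^ Suc k"
        by (rule Maclaurin_all_le[where diff = "\<lambda>m. (deriv ^^ m) g"])
          (simp, auto intro!: smooth_has_deriv smooth_funpow_deriv g)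
      then obtain t where t: "\<bar>t\<bar> \<le> \<bar>x\<bar>"
        and gx: "g x = (\<Sum>m<Suc k. ((deriv ^^ m) g 0 / fact m) * x ^ m)
          + ((deriv ^^ Suc k) g t / fact (Suc k)) * x ^ Suc k"
        by blast
      \<comment> \<open>Only the last index \<open>k\<close> survives, the smaller ones being zero
        by induction.\<close>
      have "(\<Sum>m<Suc k. ((deriv ^^ m) g 0 / fact m) * x ^ m) = a / fact k * x ^ k"
        using less.IH by (simp add: a_def)
      then have eq: "a / fact k * x ^ k = g x - ((deriv ^^ Suc k) g t / fact (Suc k)) * x ^ Suc k"
        using gx by simp
      have tb: "\<bar>(deriv ^^ Suc k) g t / fact (Suc k)\<bar> \<le> B / fact (Suc k)"
      proof -
        have "\<bar>(deriv ^^ Suc k) g t\<bar> \<le> B" using t x by (intro B) auto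
        from divide_right_mono[OF this fact_ge_zero] show ?thesis
          by (simp only: abs_divide abs_of_pos[OF fact_gt_zero])
      qed
      have "\<bar>a / fact k\<bar> * x ^ k = \<bar>a / fact k * x ^ k\<bar>"
        using x by (simp add: abs_mult)
      also have "\<dots> \<le> \<bar>g x\<bar> + \<bar>((deriv ^^ Suc k) g t / fact (Suc k)) * x ^ Suc k\<bar>"
        unfolding eq by (rule abs_triangle_ineq4)
      also have "\<dots> \<le> C * x ^ Suc k + B / fact (Suc k) * x ^ Suc k"
      proof (rule add_mono)
        show "\<bar>g x\<bar> \<le> C * x ^ Suc k" using C[of x] x by simp
        show "\<bar>((deriv ^^ Suc k) g t / fact (Suc k)) * x ^ Suc k\<bar> \<le> B / fact (Suc k) * x ^ Suc k"
        proof -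
          have "\<bar>x ^ Suc k\<bar> = x ^ Suc k" "0 \<le> x ^ Suc k" using x by simp_all
          with mult_right_mono[OF tb this(2)] show ?thesis by (simp only: abs_mult)
        qed
      qed
      also have "\<dots> = (C + B / fact (Suc k)) * x * x ^ k"
        by (simp only: distrib_right power_Suc mult.assoc)
      finally show ?thesis by (rule mult_right_le_imp_le) (use x in simp)
    qed
    have "((\<lambda>x. (C + B / fact (Suc k)) * x) \<longlongrightarrow> (C + B / fact (Suc k)) * 0) (at_right 0)"
      by (intro tendsto_intros)
    moreover have "\<forall>\<^sub>F x in at_right (0::real). \<bar>a / fact k\<bar> \<le> (C + B / fact (Suc k)) * x"
      using eventually_at_right_real[OF zero_less_one] by eventually_elim (rule le, auto)
    ultimately have "\<bar>a / fact k\<bar> \<le> (C + B / fact (Suc k)) * 0"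
      by (intro tendsto_lowerbound) auto
    then have "a / fact k = 0" by (simp only: mult_zero_right abs_le_zero_iff)
    then show ?case by (simp add: a_def)
  qed
qed

section \<open>Partial derivatives and weighted averages along a period\<close>

definition dp :: "(real \<times> real \<Rightarrow> real) \<Rightarrow> real \<times> real \<Rightarrow> real" where
  "dp f x = frechet_derivative f (at x) (1, 0)"

definition dq :: "(real \<times> real \<Rightarrow> real) \<Rightarrow> real \<times> real \<Rightarrow> real" where
  "dq f x = frechet_derivative f (at x) (0, 1)"

lemma smooth_dp: "smooth f \<Longrightarrow> smooth (dp f)"
  using smooth_frechet_derivative[of f "(1, 0)"] by (simp add: dp_def[abs_def])

lemma smooth_dq: "smooth f \<Longrightarrow> smooth (dq f)"
  using smooth_frechet_derivative[of f "(0, 1)"] by (simp add: dq_def[abs_def])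

lemma frechet_derivative_dp_dq:
  assumes "smooth f"
  shows "frechet_derivative f (at x) (a, b) = dp f x * a + dq f x * b"
proof -
  interpret bounded_linear "frechet_derivative f (at x)"
    using smooth_has_derivative[OF assms] by (rule has_derivative_bounded_linear)
  have "frechet_derivative f (at x) (a, b) = frechet_derivative f (at x) (a *\<^sub>R (1, 0) + b *\<^sub>R (0, 1))"
    by simp
  also have "\<dots> = dp f x * a + dq f x * b"
    by (simp only: add scaleR dp_def dq_def) simp
  finally show ?thesis .
qed

lemma smooth_continuous_compose:
  assumes "smooth f" "continuous_on S a"
  shows "continuous_on S (\<lambda>t. f (a t))"
  by (rule continuous_on_compose2[OF smooth_continuous_on[OF assms(1), of UNIV] assms(2)]) simp

lemma smooth_chain:
  assumes f: "smooth f" and "(a has_real_derivative a') (at s)" "(b has_real_derivative b') (at s)"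
  shows "((\<lambda>s. f (a s, b s)) has_real_derivative dp f (a s, b s) * a' + dq f (a s, b s) * b') (at s)"
proof -
  have "((\<lambda>s. (a s, b s)) has_derivative (\<lambda>h. (a' * h, b' * h))) (at s)"
    using assms(2,3) by (intro has_derivative_Pair) (simp_all add: has_field_derivative_def)
  from has_derivative_compose[OF this smooth_has_derivative[OF f]]
  have "((\<lambda>s. f (a s, b s)) has_derivative
      (\<lambda>h. dp f (a s, b s) * (a' * h) + dq f (a s, b s) * (b' * h))) (at s)"
    by (simp only: frechet_derivative_dp_dq[OF f])
  then show ?thesis
    unfolding has_field_derivative_def by (rule has_derivative_eq_rhs) (simp add: fun_eq_iff algebra_simps)
qed

text \<open>The integral runs over \<open>t = p / q\<close> rather than over \<open>p\<close>, which keeps it smooth across \<open>q = 0\<close>.\<close>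

definition wavg :: "(real \<Rightarrow> real) \<Rightarrow> (real \<times> real \<Rightarrow> real) \<Rightarrow> real \<Rightarrow> real" where
  "wavg w f q = integral {0..1} (\<lambda>t. f (t * q, q) * w t)"

text \<open>For fixed \<open>t\<close> the point \<open>(t * q, q)\<close> moves with velocity
  \<open>(t, 1)\<close> in \<open>q\<close>. The factor \<open>t\<close> is absorbed into the
  weight, so the derivative consists again of averages of smooth functions and the process can be
  iterated.\<close>

lemma wavg_has_derivative:
  assumes f: "smooth f" and w: "continuous_on {0..1} w"
  shows "(wavg w f has_real_derivative wavg (\<lambda>t. w t * t) (dp f) q + wavg w (dq f) q) (at q)"
proof -
  let ?f' = "\<lambda>q t. (dp f (t * q, q) * t + dq f (t * q, q)) * w t"
  have w': "continuous_on (S \<times> {0..1}) (\<lambda>x. w (snd x))" for S :: "real set"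
    by (rule continuous_on_compose2[OF w]) (auto intro!: continuous_intros)
  have "((\<lambda>q. integral (cbox 0 1) (\<lambda>t. f (t * q, q) * w t)) has_field_derivative
      integral (cbox 0 1) (?f' q)) (at q within UNIV)"
  proof (rule leibniz_rule_field_derivative)
    fix q t :: real
    show "((\<lambda>q. f (t * q, q) * w t) has_field_derivative ?f' q t) (at q within UNIV)"
      by (auto intro!: derivative_eq_intros smooth_chain[OF f])
    show "(\<lambda>t. f (t * q, q) * w t) integrable_on cbox 0 1"
      by (intro integrable_continuous continuous_intros smooth_continuous_compose[OF f]) (simp add: w)
    show "continuous_on (UNIV \<times> cbox 0 1) (\<lambda>(q, t). ?f' q t)"
      unfolding split_beta cbox_interval
      by (intro continuous_intros smooth_continuous_compose[OF smooth_dp[OF f]]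
          smooth_continuous_compose[OF smooth_dq[OF f]] w')
  qed auto
  moreover have "integral {0..1} (?f' q)
      = integral {0..1} (\<lambda>t. dp f (t * q, q) * (w t * t) + dq f (t * q, q) * w t)"
    by (intro integral_cong) (simp add: algebra_simps)
  moreover have "\<dots> = wavg (\<lambda>t. w t * t) (dp f) q + wavg w (dq f) q"
    unfolding wavg_def
    by (intro Henstock_Kurzweil_Integration.integral_add integrable_continuous_real continuous_intros
        smooth_continuous_compose[OF smooth_dp[OF f]] smooth_continuous_compose[OF smooth_dq[OF f]] w)
  ultimately show ?thesis by (simp add: wavg_def[abs_def])
qed

lemma Ck_wavg:
  assumes "smooth f" "continuous_on {0..1} w"
  shows "Ck k (wavg w f)"
  using assms
proof (induction k arbitrary: f w)
  case 0
  then show ?case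
    using wavg_has_derivative by (auto intro!: continuous_at_imp_continuous_on DERIV_isCont)
next
  case (Suc k)
  let ?D = "\<lambda>q. wavg (\<lambda>t. w t * t) (dp f) q + wavg w (dq f) q"
  have D: "(wavg w f has_derivative (\<lambda>v. ?D q * v)) (at q)" for q
    using wavg_has_derivative[OF Suc.prems] by (simp add: has_field_derivative_def)
  \<comment> \<open>The direction \<open>v\<close> is distributed over both averages so that the
    expression is a linear combination with constant coefficients.\<close>
  have "Ck k (\<lambda>q. v * wavg (\<lambda>t. w t * t) (dp f) q + v * wavg w (dq f) q)" for v
    by (intro Ck_linear_combination Suc.IH smooth_dp smooth_dq Suc.prems continuous_intros)
  moreover have "frechet_derivative (wavg w f) (at q) v
      = v * wavg (\<lambda>t. w t * t) (dp f) q + v * wavg w (dq f) q" for q v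
    using frechet_derivative_at[OF D, of q] by (metis distrib_left mult.commute)
  moreover have "wavg w f differentiable at q" for q
    using D by (rule differentiableI)
  ultimately show ?case by simp
qed

subsection \<open>Fourier coefficients of invariant functions\<close>

lemma smooth_invariant_smooth: "f \<in> smooth_invariant \<Longrightarrow> smooth f"
  by (simp add: smooth_invariant_def)

lemma smooth_invariant_shift: "f \<in> smooth_invariant \<Longrightarrow> f (p + of_int n * q, q) = f (p, q)"
  unfolding smooth_invariant_def shear_def by auto

text \<open>At fixed \<open>q\<close> the shear is a translation in \<open>p\<close>, so
  differentiating the invariance in \<open>p\<close> produces no extra factor. The derivative in
  \<open>q\<close> would instead pick up a term \<open>of_int n * dp f\<close>.\<close>

lemma smooth_invariant_dp:
  assumes "f \<in> smooth_invariant"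
  shows "dp f \<in> smooth_invariant"
proof -
  have f: "smooth f" using assms by (rule smooth_invariant_smooth)
  have "dp f (p + of_int n * q, q) = dp f (p, q)" for p q n
  proof -
    have "((\<lambda>p. f (p + of_int n * q, q)) has_real_derivative
        dp f (p + of_int n * q, q) * 1 + dq f (p + of_int n * q, q) * 0) (at p)"
      by (rule smooth_chain[OF f]) (auto intro!: derivative_eq_intros)
    then have "((\<lambda>p. f (p, q)) has_real_derivative dp f (p + of_int n * q, q)) (at p)"
      by (simp add: smooth_invariant_shift[OF assms])
    moreover have "((\<lambda>p. f (p, q)) has_real_derivative dp f (p, q) * 1 + dq f (p, q) * 0) (at p)"
      by (rule smooth_chain[OF f]) (auto intro!: derivative_eq_intros)
    ultimately show ?thesis using DERIV_unique by fastforce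
  qed
  then show ?thesis using smooth_dp[OF f] by (auto simp: smooth_invariant_def shear_def)
qed

text \<open>Along \<open>q = p / n\<close> the points \<open>(p, q)\<close> and \<open>(0, q)\<close> lie in the same orbit.\<close>

lemma smooth_invariant_axis:
  assumes "f \<in> smooth_invariant"
  shows "f (p, 0) = f (0, 0)"
proof (rule LIMSEQ_unique)
  have f: "isCont f x" for x
    using smooth_continuous_on[OF smooth_invariant_smooth[OF assms], of UNIV]
    by (metis UNIV_I continuous_on_eq_continuous_at open_UNIV)
  have lim: "(\<lambda>n. p / real (Suc n)) \<longlonglongrightarrow> 0"
    using tendsto_mult_right_zero[OF LIMSEQ_inverse_real_of_nat, of p] by (simp add: divide_inverse)
  show "(\<lambda>n. f (p, p / real (Suc n))) \<longlonglongrightarrow> f (p, 0)"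
    by (intro isCont_tendsto_compose[OF f] tendsto_Pair tendsto_const lim)
  have "f (p, p / real (Suc n)) = f (0, p / real (Suc n))" for n
    using smooth_invariant_shift[OF assms, of 0 "int (Suc n)" "p / real (Suc n)"] by simp
  moreover have "(\<lambda>n. f (0, p / real (Suc n))) \<longlonglongrightarrow> f (0, 0)"
    by (intro isCont_tendsto_compose[OF f] tendsto_Pair tendsto_const lim)
  ultimately show "(\<lambda>n. f (p, p / real (Suc n))) \<longlonglongrightarrow> f (0, 0)" by simp
qed

section \<open>Integration by parts and decay of the coefficients\<close>

text \<open>Fourier coefficients of \<open>t \<mapsto> f (t * q, q)\<close>, without the factor 2
  that the series carries at positive frequencies.\<close>

abbreviation cos_coeff :: "nat \<Rightarrow> (real \<times> real \<Rightarrow> real) \<Rightarrow> real \<Rightarrow> real" where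
  "cos_coeff n \<equiv> wavg (\<lambda>t. cos (2 * real n * pi * t))"

abbreviation sin_coeff :: "nat \<Rightarrow> (real \<times> real \<Rightarrow> real) \<Rightarrow> real \<Rightarrow> real" where
  "sin_coeff n \<equiv> wavg (\<lambda>t. sin (2 * real n * pi * t))"

text \<open>The \<open>t\<close>-derivative of \<open>f (t * q, q)\<close> is \<open>q\<close> times
  \<open>dp f\<close>, and the boundary terms cancel because \<open>(q, q)\<close> and
  \<open>(0, q)\<close> lie in one orbit and \<open>W\<close> agrees at the endpoints.\<close>

lemma wavg_by_parts:
  assumes f: "f \<in> smooth_invariant"
    and W: "\<And>t. (W has_real_derivative w t) (at t)" and w: "continuous_on {0..1} w"
    and per: "W 1 = W 0"
  shows "wavg w f q = - q * wavg W (dp f) q"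
proof -
  have sf: "smooth f" using f by (rule smooth_invariant_smooth)
  have W': "continuous_on {0..1} W"
    using W by (auto intro!: continuous_at_imp_continuous_on DERIV_isCont)
  have "((\<lambda>t. f (t * q, q) * w t + q * (dp f (t * q, q) * W t)) has_integral
      f (1 * q, q) * W 1 - f (0 * q, q) * W 0) {0..1}"
  proof (rule fundamental_theorem_of_calculus)
    fix t :: real
    have "((\<lambda>t. f (t * q, q)) has_real_derivative dp f (t * q, q) * q + dq f (t * q, q) * 0) (at t)"
      by (rule smooth_chain[OF sf]) (auto intro!: derivative_eq_intros)
    from DERIV_mult[OF this W]
    have "((\<lambda>t. f (t * q, q) * W t) has_real_derivative f (t * q, q) * w t + q * (dp f (t * q, q) * W t)) (at t)"
      by (rule DERIV_cong) (simp add: algebra_simps)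
    then show "((\<lambda>t. f (t * q, q) * W t) has_vector_derivative f (t * q, q) * w t + q * (dp f (t * q, q) * W t))
        (at t within {0..1})"
      using DERIV_subset has_real_derivative_iff_has_vector_derivative by blast
  qed simp
  moreover have "f (1 * q, q) = f (0 * q, q)"
    using smooth_invariant_shift[OF f, of 0 1 q] by simp
  ultimately have "integral {0..1} (\<lambda>t. f (t * q, q) * w t + q * (dp f (t * q, q) * W t)) = 0"
    by (simp only: per diff_self integral_unique)
  moreover have "integral {0..1} (\<lambda>t. f (t * q, q) * w t + q * (dp f (t * q, q) * W t))
      = wavg w f q + integral {0..1} (\<lambda>t. q * (dp f (t * q, q) * W t))"
    unfolding wavg_def
    by (intro Henstock_Kurzweil_Integration.integral_add integrable_continuous_real continuous_intros
        smooth_continuous_compose[OF smooth_dp[OF sf]] smooth_continuous_compose[OF sf] w W')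
  moreover have "integral {0..1} (\<lambda>t. q * (dp f (t * q, q) * W t)) = q * wavg W (dp f) q"
    unfolding wavg_def by (rule Henstock_Kurzweil_Integration.integral_mult_right)
  ultimately show ?thesis by linarith
qed

lemma wavg_cmult: "wavg (\<lambda>t. c * w t) f q = c * wavg w f q"
proof -
  have "wavg (\<lambda>t. c * w t) f q = integral {0..1} (\<lambda>t. c * (f (t * q, q) * w t))"
    by (simp add: wavg_def mult_ac)
  then show ?thesis unfolding wavg_def by (simp only: Henstock_Kurzweil_Integration.integral_mult_right)
qed

lemma cos_coeff_by_parts:
  assumes "f \<in> smooth_invariant" "n \<ge> 1"
  shows "cos_coeff n f q = - (q / (2 * real n * pi)) * sin_coeff n (dp f) q"
proof -
  have "cos_coeff n f q = - q * wavg (\<lambda>t. (1 / (2 * real n * pi)) * sin (2 * real n * pi * t)) (dp f) q"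
  proof (rule wavg_by_parts[OF assms(1)])
    show "((\<lambda>t. 1 / (2 * real n * pi) * sin (2 * real n * pi * t)) has_real_derivative
        cos (2 * real n * pi * t)) (at t)" for t
      using assms(2) by (auto intro!: derivative_eq_intros)
  qed (auto intro!: continuous_intros)
  then show ?thesis by (simp only: wavg_cmult) simp
qed

lemma sin_coeff_by_parts:
  assumes "f \<in> smooth_invariant" "n \<ge> 1"
  shows "sin_coeff n f q = (q / (2 * real n * pi)) * cos_coeff n (dp f) q"
proof -
  have "sin_coeff n f q = - q * wavg (\<lambda>t. (- 1 / (2 * real n * pi)) * cos (2 * real n * pi * t)) (dp f) q"
  proof (rule wavg_by_parts[OF assms(1)])
    show "((\<lambda>t. - 1 / (2 * real n * pi) * cos (2 * real n * pi * t)) has_real_derivative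
        sin (2 * real n * pi * t)) (at t)" for t
      using assms(2) by (auto intro!: derivative_eq_intros)
  qed (auto intro!: continuous_intros)
  then show ?thesis by (simp only: wavg_cmult) simp
qed

text \<open>The bound must not depend on the weight, so that one constant serves the sines and
  cosines of all frequencies.\<close>

lemma wavg_bounded:
  assumes f: "smooth f"
  shows "\<exists>K. \<forall>w q. \<bar>q\<bar> \<le> R \<longrightarrow> continuous_on {0..1} w \<longrightarrow> (\<forall>t. \<bar>w t\<bar> \<le> 1) \<longrightarrow> \<bar>wavg w f q\<bar> \<le> K"
proof -
  \<comment> \<open>A compact set containing every point at which \<open>f\<close> is evaluated when
    \<open>\<bar>q\<bar> \<le> R\<close>.\<close>
  let ?Q = "(\<lambda>(t, q). (t * q, q)) ` ({0..1} \<times> {-R..R})"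
  have "compact ?Q"
    by (intro compact_continuous_image compact_Times compact_Icc)
      (auto simp: split_beta intro!: continuous_intros)
  then obtain K where K: "\<And>x. x \<in> ?Q \<Longrightarrow> \<bar>f x\<bar> \<le> K"
    using continuous_on_compact_bound[OF \<open>compact ?Q\<close> smooth_continuous_on[OF f]]
    unfolding real_norm_def by blast
  have "\<bar>wavg w f q\<bar> \<le> K" if "\<bar>q\<bar> \<le> R" "continuous_on {0..1} w" "\<forall>t. \<bar>w t\<bar> \<le> 1" for w q
  proof -
    have "norm (integral {0..1} (\<lambda>t. f (t * q, q) * w t)) \<le> K * (1 - 0)"
    proof (rule integral_bound)
      show "continuous_on {0..1} (\<lambda>t. f (t * q, q) * w t)"
        by (intro continuous_intros smooth_continuous_compose[OF f] that(2))
      fix t :: real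
      assume "t \<in> {0..1}"
      then have "\<bar>f (t * q, q)\<bar> \<le> K" using that(1) by (intro K) force
      then have "\<bar>f (t * q, q)\<bar> * \<bar>w t\<bar> \<le> K * 1" using that(3) by (intro mult_mono) auto
      then show "norm (f (t * q, q) * w t) \<le> K" by (simp add: abs_mult)
    qed simp
    then show ?thesis by (simp add: wavg_def)
  qed
  then show ?thesis by blast
qed

text \<open>Each integration by parts gains a factor
  \<open>\<bar>q\<bar> / (2 * real n * pi)\<close> and passes to \<open>dp f\<close>, which is again
  invariant; hence the induction on \<open>m\<close> is over all invariant \<open>f\<close>.\<close>

lemma fourier_coeff_decay:
  assumes "f \<in> smooth_invariant"
  shows "\<exists>K\<ge>0. \<forall>n\<ge>1. \<forall>q. \<bar>q\<bar> \<le> R \<longrightarrow>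
    \<bar>cos_coeff n f q\<bar> \<le> K * (\<bar>q\<bar> / real n) ^ m \<and> \<bar>sin_coeff n f q\<bar> \<le> K * (\<bar>q\<bar> / real n) ^ m"
  using assms
proof (induction m arbitrary: f)
  case 0
  obtain K where K: "\<And>w q. \<bar>q\<bar> \<le> R \<Longrightarrow> continuous_on {0..1} w \<Longrightarrow> (\<forall>t. \<bar>w t\<bar> \<le> 1) \<Longrightarrow> \<bar>wavg w f q\<bar> \<le> K"
    using wavg_bounded[OF smooth_invariant_smooth[OF 0], of R] by blast
  have "\<bar>cos_coeff n f q\<bar> \<le> K" "\<bar>sin_coeff n f q\<bar> \<le> K" if "\<bar>q\<bar> \<le> R" for n q
    by (rule K[OF that]; force intro!: continuous_intros)+
  \<comment> \<open>For negative \<open>R\<close> nothing forces \<open>K\<close> to be nonnegative,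
    whence the maximum with 0. The power 0 equals 1 even at \<open>q = 0\<close>.\<close>
  then show ?case by (intro exI[of _ "max K 0"]) (auto simp: le_max_iff_disj)
next
  case (Suc m)
  obtain K where K: "K \<ge> 0" "\<And>n q. n \<ge> 1 \<Longrightarrow> \<bar>q\<bar> \<le> R \<Longrightarrow> \<bar>cos_coeff n (dp f) q\<bar> \<le> K * (\<bar>q\<bar> / real n) ^ m"
    "\<And>n q. n \<ge> 1 \<Longrightarrow> \<bar>q\<bar> \<le> R \<Longrightarrow> \<bar>sin_coeff n (dp f) q\<bar> \<le> K * (\<bar>q\<bar> / real n) ^ m"
    using Suc.IH[OF smooth_invariant_dp[OF Suc.prems]] by blast
  have step: "\<bar>q / (2 * real n * pi)\<bar> * y \<le> K * (\<bar>q\<bar> / real n) ^ Suc m"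
    if "n \<ge> 1" "0 \<le> y" "y \<le> K * (\<bar>q\<bar> / real n) ^ m" for n q y
  proof -
    \<comment> \<open>Since \<open>2 * pi\<close> exceeds 1, dropping it from the denominator only
      weakens the bound.\<close>
    have "1 * real n \<le> (2 * pi) * real n"
      using pi_gt3 by (intro mult_right_mono) auto
    then have "\<bar>q / (2 * real n * pi)\<bar> \<le> \<bar>q\<bar> / real n"
      unfolding abs_divide using that(1) by (intro divide_left_mono) (auto simp: mult_ac abs_mult)
    then have "\<bar>q / (2 * real n * pi)\<bar> * y \<le> (\<bar>q\<bar> / real n) * (K * (\<bar>q\<bar> / real n) ^ m)"
      using that by (intro mult_mono) auto
    then show ?thesis by (simp only: power_Suc mult.left_commute)
  qed
  have "\<bar>cos_coeff n f q\<bar> \<le> K * (\<bar>q\<bar> / real n) ^ Suc m" "\<bar>sin_coeff n f q\<bar> \<le> K * (\<bar>q\<bar> / real n) ^ Suc m"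
    if "n \<ge> 1" "\<bar>q\<bar> \<le> R" for n q
    unfolding cos_coeff_by_parts[OF Suc.prems that(1)] sin_coeff_by_parts[OF Suc.prems that(1)] abs_mult abs_minus
    using that K by (intro step; auto)+
  then show ?case using K(1) by blast
qed

section \<open>Normal convergence on balls\<close>

lemma abs_convergent_on_ballI:
  fixes u :: "nat \<Rightarrow> real \<times> real \<Rightarrow> real"
  assumes bound: "\<And>n x. n \<ge> 1 \<Longrightarrow> x \<in> ball c r \<Longrightarrow> \<bar>u n x\<bar> \<le> K / real n ^ 2" and r: "r > 0"
  shows "abs_convergent_on (ball c r) u"
  unfolding abs_convergent_on_def
proof (intro conjI allI impI)
  fix n :: nat
  assume "n \<ge> 1"
  then show "bounded (u n ` ball c r)"
    using bound by (intro boundedI[of _ "K / real n ^ 2"]) auto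
next
  have c: "c \<in> ball c r" using r by simp
  show "summable (\<lambda>n. SUP x\<in>ball c r. \<bar>u (Suc n) x\<bar>)"
  proof (rule summable_comparison_test')
    have "summable (\<lambda>n. inverse (real (Suc n) ^ 2))"
      using inverse_power_summable[of 2, where 'a = real] by (subst summable_Suc_iff) simp
    then show "summable (\<lambda>n. K * inverse (real (Suc n) ^ 2))" by (rule summable_mult)
    fix n
    have le: "\<bar>u (Suc n) x\<bar> \<le> K * inverse (real (Suc n) ^ 2)" if "x \<in> ball c r" for x
      using bound[of "Suc n" x] that by (simp add: divide_inverse)
    then have "(SUP x\<in>ball c r. \<bar>u (Suc n) x\<bar>) \<le> K * inverse (real (Suc n) ^ 2)"
      using c by (intro cSUP_least) auto
    moreover have "0 \<le> (SUP x\<in>ball c r. \<bar>u (Suc n) x\<bar>)"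
      \<comment> \<open>The supremum dominates the nonnegative value at the centre; this needs the
        set of values to be bounded above, which \<open>le\<close> provides.\<close>
      by (rule cSUP_upper2[OF _ c]) (use le in \<open>auto intro!: bdd_aboveI2\<close>)
    ultimately show "norm (SUP x\<in>ball c r. \<bar>u (Suc n) x\<bar>) \<le> K * inverse (real (Suc n) ^ 2)" by simp
  qed
qed

section \<open>Assembly of the expansion\<close>

theorem proposition2p6:
  fixes f :: "real \<times> real \<Rightarrow> real"
  assumes "f \<in> smooth_invariant"
  shows "\<exists>(\<alpha> :: nat \<Rightarrow> real \<Rightarrow> real) (\<beta> :: nat \<Rightarrow> real \<Rightarrow> real).
           smooth (\<alpha> 0) \<and>
           (\<forall>n\<ge>1. smooth (\<alpha> n) \<and> flat_at (\<alpha> n) 0 \<and> smooth (\<beta> n) \<and> flat_at (\<beta> n) 0) \<and>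
           (\<forall>c r. r > 0 \<longrightarrow>
              abs_convergent_on (ball c r) (cos_term \<alpha>) \<and>
              abs_convergent_on (ball c r) (sin_term \<beta>)) \<and>
           (\<forall>p q. f (p, q) = \<alpha> 0 q + (\<Sum>n. cos_term \<alpha> (Suc n) (p, q))
                                  + (\<Sum>n. sin_term \<beta> (Suc n) (p, q)))"
proof -
  \<comment> \<open>The constant term is the mean over a period; positive frequencies carry the
    usual factor 2.\<close>
  define \<alpha> where "\<alpha> n q = (if n = 0 then 1 else 2) * cos_coeff n f q" for n q
  define \<beta> where "\<beta> n q = 2 * sin_coeff n f q" for n q
  have sf: "smooth f" using assms by (rule smooth_invariant_smooth)
  have smooth: "smooth (\<alpha> n)" "smooth (\<beta> n)" for n
    unfolding smooth_def \<alpha>_def[abs_def] \<beta>_def[abs_def]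
    by (auto intro!: Ck_cmult Ck_wavg[OF sf] continuous_intros)
  have decay: "\<exists>K\<ge>0. \<forall>n\<ge>1. \<forall>q. \<bar>q\<bar> \<le> R \<longrightarrow>
      \<bar>\<alpha> n q\<bar> \<le> K * (\<bar>q\<bar> / real n) ^ m \<and> \<bar>\<beta> n q\<bar> \<le> K * (\<bar>q\<bar> / real n) ^ m" for R m
  proof -
    obtain K where "K \<ge> 0" "\<forall>n\<ge>1. \<forall>q. \<bar>q\<bar> \<le> R \<longrightarrow>
      \<bar>cos_coeff n f q\<bar> \<le> K * (\<bar>q\<bar> / real n) ^ m \<and> \<bar>sin_coeff n f q\<bar> \<le> K * (\<bar>q\<bar> / real n) ^ m"
      using fourier_coeff_decay[OF assms] by blast
    then show ?thesis
      by (intro exI[of _ "2 * K"]) (auto simp: \<alpha>_def \<beta>_def abs_mult)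
  qed
  have flat: "flat_at (\<alpha> n) 0 \<and> flat_at (\<beta> n) 0" if n: "n \<ge> 1" for n
  proof -
    have "\<exists>C. \<forall>q. \<bar>q\<bar> \<le> 1 \<longrightarrow> \<bar>\<alpha> n q\<bar> \<le> C * \<bar>q\<bar> ^ m \<and> \<bar>\<beta> n q\<bar> \<le> C * \<bar>q\<bar> ^ m" for m
    proof -
      obtain K where "\<forall>q. \<bar>q\<bar> \<le> 1 \<longrightarrow>
          \<bar>\<alpha> n q\<bar> \<le> K * (\<bar>q\<bar> / real n) ^ m \<and> \<bar>\<beta> n q\<bar> \<le> K * (\<bar>q\<bar> / real n) ^ m"
        using decay[of 1 m] n by blast
      then show ?thesis
        \<comment> \<open>Flatness concerns one \<open>n\<close> at a time, so the power of
          \<open>n\<close> may enter the constant.\<close>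
        by (intro exI[of _ "K / real n ^ m"]) (simp add: power_divide)
    qed
    then show ?thesis by (intro conjI flat_at_0I smooth) blast+
  qed
  \<comment> \<open>Exponent 2 is enough for a summable majorant, uniform for
    \<open>\<bar>q\<bar> \<le> R\<close>.\<close>
  have quad: "\<exists>K. \<forall>n\<ge>1. \<forall>q. \<bar>q\<bar> \<le> R \<longrightarrow> \<bar>\<alpha> n q\<bar> \<le> K / real n ^ 2 \<and> \<bar>\<beta> n q\<bar> \<le> K / real n ^ 2" for R
  proof -
    obtain K where K: "K \<ge> 0" "\<forall>n\<ge>1. \<forall>q. \<bar>q\<bar> \<le> R \<longrightarrow>
        \<bar>\<alpha> n q\<bar> \<le> K * (\<bar>q\<bar> / real n) ^ 2 \<and> \<bar>\<beta> n q\<bar> \<le> K * (\<bar>q\<bar> / real n) ^ 2"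
      using decay[of R 2] by blast
    have "K * (\<bar>q\<bar> / real n) ^ 2 \<le> (K * R ^ 2) / real n ^ 2" if "\<bar>q\<bar> \<le> R" for n q
    proof -
      have "\<bar>q\<bar> ^ 2 \<le> R ^ 2" using that by (intro power_mono) auto
      then show ?thesis using K(1) by (auto simp: power_divide intro!: divide_right_mono mult_left_mono)
    qed
    then show ?thesis using K(2) by (intro exI[of _ "K * R ^ 2"]) (meson order_trans)
  qed
  have conv: "abs_convergent_on (ball c r) (cos_term \<alpha>) \<and> abs_convergent_on (ball c r) (sin_term \<beta>)"
    if r: "r > 0" for c r
  proof -
    \<comment> \<open>On the ball of centre \<open>c\<close> and radius \<open>r\<close> the second
      coordinate is at most \<open>norm c + r\<close> in absolute value.\<close>
    obtain K where K: "\<And>n q. n \<ge> 1 \<Longrightarrow> \<bar>q\<bar> \<le> norm c + r \<Longrightarrow> \<bar>\<alpha> n q\<bar> \<le> K / real n ^ 2"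
      "\<And>n q. n \<ge> 1 \<Longrightarrow> \<bar>q\<bar> \<le> norm c + r \<Longrightarrow> \<bar>\<beta> n q\<bar> \<le> K / real n ^ 2"
      using quad by blast
    have q: "\<bar>snd x\<bar> \<le> norm c + r" if "x \<in> ball c r" for x
    proof -
      have "\<bar>snd x\<bar> \<le> norm x" by (cases x) (simp add: norm_snd_le flip: real_norm_def)
      also have "\<dots> \<le> norm c + r"
        using that norm_triangle_sub[of x c] by (simp add: dist_norm norm_minus_commute)
      finally show ?thesis .
    qed
    have le: "\<bar>cos_term \<alpha> n x\<bar> \<le> \<bar>\<alpha> n (snd x)\<bar>" "\<bar>sin_term \<beta> n x\<bar> \<le> \<bar>\<beta> n (snd x)\<bar>" for n x
      by (auto simp: cos_term_def sin_term_def split_beta abs_mult mult_left_le)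
    show ?thesis
      by (intro conjI abs_convergent_on_ballI[OF _ r, where K = K])
        (meson le K q order_trans)+
  qed
  have "f (p, q) = \<alpha> 0 q + (\<Sum>n. cos_term \<alpha> (Suc n) (p, q)) + (\<Sum>n. sin_term \<beta> (Suc n) (p, q))" for p q
  proof (cases "q = 0")
    case True
    \<comment> \<open>On the axis both series are zero by convention, and
      \<open>\<alpha> 0 0\<close> is the integral of the constant \<open>f (0, 0)\<close>, which is
      the value of \<open>f\<close> on the whole axis.\<close>
    then show ?thesis
      using smooth_invariant_axis[OF assms, of p]
      by (simp add: cos_term_def sin_term_def \<alpha>_def wavg_def)
  next
    case False
    obtain K where K: "\<And>n. n \<ge> 1 \<Longrightarrow> \<bar>\<alpha> n q\<bar> \<le> K / real n ^ 2" "\<And>n. n \<ge> 1 \<Longrightarrow> \<bar>\<beta> n q\<bar> \<le> K / real n ^ 2"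
      using quad[of "\<bar>q\<bar>"] by auto
    have s: "summable (\<lambda>n. K * inverse (real n ^ 2))"
      by (intro summable_mult inverse_power_summable) simp
    have "\<bar>cos_coeff n f q\<bar> \<le> K * inverse (real n ^ 2)" "\<bar>sin_coeff n f q\<bar> \<le> K * inverse (real n ^ 2)"
      if "n \<ge> 1" for n
      using K[OF that] that by (auto simp: \<alpha>_def \<beta>_def abs_mult divide_inverse)
    then have sum: "summable (\<lambda>n. \<bar>cos_coeff n f q\<bar>)" "summable (\<lambda>n. \<bar>sin_coeff n f q\<bar>)"
      by (auto intro!: summable_comparison_test'[OF s, of 1])
    \<comment> \<open>The Fourier series of \<open>t \<mapsto> f (t * q, q)\<close> is evaluated at
      \<open>t = p / q\<close>; its period is 1 by invariance under the generator of the
      group.\<close>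
    have "f (p / q * q, q) = cos_coeff 0 f q
        + (\<Sum>n. 2 * cos_coeff (Suc n) f q * cos (2 * real (Suc n) * pi * (p / q)))
        + (\<Sum>n. 2 * sin_coeff (Suc n) f q * sin (2 * real (Suc n) * pi * (p / q)))"
      unfolding wavg_def
    proof (rule periodic_fourier_expansion)
      show "continuous_on UNIV (\<lambda>t. f (t * q, q))"
        by (intro smooth_continuous_compose[OF sf] continuous_intros)
      show "f ((t + 1) * q, q) = f (t * q, q)" for t
        using smooth_invariant_shift[OF assms, of "t * q" 1 q] by (simp add: distrib_right)
    qed (use sum in \<open>simp_all only: wavg_def\<close>)
    then show ?thesis
      using False by (simp only: cos_term_def sin_term_def \<alpha>_def \<beta>_def) simp
  qed
  then show ?thesis using smooth flat conv by blast
qed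

end
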